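(* Let $k,n$ be integers with $1\le k\le n$. Then, for all complex $x$ with $|x|<\tfrac12$, $$Hl\left(\tfrac12,(2k-1)(k+n);\,2(k+n),\,2k-1;\,2k,\,2k;\,x\right)=2^{2k-1}\binom{n+k-1}{k-1}^{-1}\binom{n-1}{k-1}^{-1}\sum_{i=0}^{n-k}\binom{2n-2i-2}{2k-2}\binom{n-1}{i}r_{n,k+i}(1-2x)^{1-2n+2i}$$ and $$Hl\left(\tfrac12,(2k-1)(k+n);\,2(k+n),\,2k-1;\,2k,\,2k;\,x\right)=(1-2x)^{1-2n}\sum_{j=0}^{n-k}4^j\binom{n-k}{j}\frac{(k+1/2)_j}{(2k)_j}(x^2-x)^j.$$
   Context: Heun function: for $a\notin\{0,1\}$, $\gamma\notin\{0,-1,-2,\dots\}$ and $\epsilon$ defined by $\alpha+\beta+1=\gamma+\delta+\epsilon$, $Hl(a,q;\alpha,\beta;\gamma,\delta;x)$ denotes the (local) Heun function, i.e. the solution $u(x)$, analytic near $x=0$ and normalized by $u(0)=1$, of $$u''(x)+\left(\frac{\gamma}{x}+\frac{\delta}{x-1}+\frac{\epsilon}{x-a}\right)u'(x)+\frac{\alpha\beta x-q}{x(x-1)(x-a)}u(x)=0.$$ (For $a=\tfrac12$ its power series at $0$ converges for $|x|<\tfrac12$.) Notation: $(y)_0:=1$, $(y)_l:=y(y+1)\cdots(y+l-1)$ for $l\ge1$; for $0\le j\le n$, $r_{n,j}:=\binom{n}{j}^{-1}4^{-n}\binom{2j}{j}\binom{2n-2j}{n-j}$. *)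

theory Defs
  imports "HOL-Complex_Analysis.Complex_Analysis"
begin

definition heun_eq ::
  "complex \<Rightarrow> complex \<Rightarrow> complex \<Rightarrow> complex \<Rightarrow> complex \<Rightarrow> complex \<Rightarrow> (complex \<Rightarrow> complex) \<Rightarrow> complex \<Rightarrow> bool"
  where
  "heun_eq a q \<alpha> \<beta> \<gamma> \<delta> u x \<longleftrightarrow>
     (let \<epsilon> = \<alpha> + \<beta> + 1 - \<gamma> - \<delta> in
        deriv (deriv u) x
        + (\<gamma> / x + \<delta> / (x - 1) + \<epsilon> / (x - a)) * deriv u x
        + (\<alpha> * \<beta> * x - q) / (x * (x - 1) * (x - a)) * u x = 0)"

(* The equation is singular at 0, so it is imposed on a punctured neighbourhood of 0;
   has_fps_expansion includes a positive radius of convergence. *)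
definition heun_local_solution ::
  "complex \<Rightarrow> complex \<Rightarrow> complex \<Rightarrow> complex \<Rightarrow> complex \<Rightarrow> complex \<Rightarrow> (complex \<Rightarrow> complex) \<Rightarrow> complex fps \<Rightarrow> bool"
  where
  "heun_local_solution a q \<alpha> \<beta> \<gamma> \<delta> u F \<longleftrightarrow>
     u has_fps_expansion F \<and> u 0 = 1 \<and> (\<forall>\<^sub>F x in at 0. heun_eq a q \<alpha> \<beta> \<gamma> \<delta> u x)"

(* The solution is unique only as a germ at 0, hence the definite description of its power
   series rather than of u.  The series is meaningful for a \<notin> {0, 1} and
   \<gamma> \<notin> {0, -1, -2, ...}; the function Hl is its sum inside the disc of convergence. *)
definition Hl_fps ::
  "complex \<Rightarrow> complex \<Rightarrow> complex \<Rightarrow> complex \<Rightarrow> complex \<Rightarrow> complex \<Rightarrow> complex fps"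
  where
  "Hl_fps a q \<alpha> \<beta> \<gamma> \<delta> = (THE F. \<exists>u. heun_local_solution a q \<alpha> \<beta> \<gamma> \<delta> u F)"

definition Hl ::
  "complex \<Rightarrow> complex \<Rightarrow> complex \<Rightarrow> complex \<Rightarrow> complex \<Rightarrow> complex \<Rightarrow> complex \<Rightarrow> complex"
  where
  "Hl a q \<alpha> \<beta> \<gamma> \<delta> x = eval_fps (Hl_fps a q \<alpha> \<beta> \<gamma> \<delta>) x"

(* r_{n,j}, used for j \<le> n only *)
definition r_coeff :: "nat \<Rightarrow> nat \<Rightarrow> complex" where
  "r_coeff n j =
     of_nat ((2 * j) choose j) * of_nat ((2 * n - 2 * j) choose (n - j))
       / (of_nat (n choose j) * 4 ^ n)"

end

theory Submission
  imports Defs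
begin

text \<open>
  For these parameters \<open>\<alpha> * \<beta> = 2 * q\<close>, so the accessory term loses the singularity at
  \<open>a = 1/2\<close>, and the equation is symmetric under \<open>x \<mapsto> 1 - x\<close>.  In the variable
  \<open>s = 1 - 2 * x\<close> (that is, \<open>s\<^sup>2 = 1 + 4 * (x\<^sup>2 - x)\<close>) it becomes
  \[(s^2-1)\,u_{ss} + \Bigl(4ks + \frac{2n(s^2-1)}{s}\Bigr) u_s + 2(2k-1)(k+n)\,u = 0,\]
  which sends \<open>s\<^bsup>\<rho>\<^esup>\<close> to a combination of \<open>s\<^bsup>\<rho>\<^esup>\<close> and \<open>s\<^bsup>\<rho>-2\<^esup>\<close> only.  Starting from the exponent
  \<open>1 - 2 * n\<close> at \<open>s = 0\<close> and raising it by two, the resulting two-term recurrence breaks off at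
  the exponent \<open>1 - 2 * k\<close> at infinity, so \<open>s\<^bsup>1-2n\<^esup>\<close> times a polynomial of degree \<open>n - k\<close> in
  \<open>s\<^sup>2\<close> solves the equation (\<open>heun_eq_half_power_sum\<close>).

  With \<open>a = k + 1/2\<close>, \<open>c = 2 * k\<close> and \<open>N = n - k\<close>, the coefficients of this polynomial are
  \<open>(N choose i) * (a)\<^sub>i * (c - a)\<^bsub>N-i\<^esub> / (c)\<^sub>N\<close>.  The Chu--Vandermonde identity turns it into a
  hypergeometric polynomial in \<open>s\<^sup>2 - 1 = 4 * (x\<^sup>2 - x)\<close> (\<open>hypergeometric_recentre\<close>); this is the
  second formula, and it also shows that the value at \<open>x = 0\<close> is one.  Writing the same
  coefficients through binomials (\<open>recentre_coeff_binomial\<close>) gives the first formula.  Finally,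
  the exponent \<open>1 - \<gamma>\<close> at \<open>x = 0\<close> is not a positive integer, so the normalized analytic solution is
  unique (\<open>Hl_eqI\<close>).
\<close>

section \<open>Uniqueness of the local Heun function\<close>

text \<open>Clearing denominators makes the equation meaningful at the singular point itself; the
  product is continuous there, so it vanishes there too.\<close>

lemma heun_local_solution_fps_eq:
  fixes a q \<alpha> \<beta> \<gamma> \<delta> :: complex
  assumes "heun_local_solution a q \<alpha> \<beta> \<gamma> \<delta> u F" and a: "a \<noteq> 0"
  defines "\<epsilon> \<equiv> \<alpha> + \<beta> + 1 - \<gamma> - \<delta>"
  shows "fps_X * (fps_X - 1) * (fps_X - fps_const a) * fps_deriv (fps_deriv F)
         + (fps_const \<gamma> * ((fps_X - 1) * (fps_X - fps_const a))
            + fps_const \<delta> * (fps_X * (fps_X - fps_const a))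
            + fps_const \<epsilon> * (fps_X * (fps_X - 1))) * fps_deriv F
         + (fps_const (\<alpha> * \<beta>) * fps_X - fps_const q) * F = 0"
    (is "?G = 0")
proof -
  from assms(1) have exp: "u has_fps_expansion F"
    and ode: "\<forall>\<^sub>F x in at 0. heun_eq a q \<alpha> \<beta> \<gamma> \<delta> u x"
    by (auto simp: heun_local_solution_def)
  define g where "g = (\<lambda>x. x * (x - 1) * (x - a) * deriv (deriv u) x
         + (\<gamma> * ((x - 1) * (x - a)) + \<delta> * (x * (x - a)) + \<epsilon> * (x * (x - 1))) * deriv u x
         + (\<alpha> * \<beta> * x - q) * u x)"
  have g: "g has_fps_expansion ?G"
    unfolding g_def by (intro fps_expansion_intros exp)
  have ne: "\<forall>\<^sub>F x in at (0::complex). x \<noteq> 0" "\<forall>\<^sub>F x in at (0::complex). x \<noteq> 1"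
    "\<forall>\<^sub>F x in at (0::complex). x \<noteq> a"
    using a by (auto intro!: eventually_neq_at_within)
  have ev: "\<forall>\<^sub>F x in at 0. g x = 0"
    using ode ne
  proof eventually_elim
    case (elim x)
    have "g x = x * (x - 1) * (x - a) * (deriv (deriv u) x
        + (\<gamma> / x + \<delta> / (x - 1) + \<epsilon> / (x - a)) * deriv u x
        + (\<alpha> * \<beta> * x - q) / (x * (x - 1) * (x - a)) * u x)"
    proof -
      have "x * P * Q * (U2 + (\<gamma> / x + \<delta> / P + \<epsilon> / Q) * U1 + R / (x * P * Q) * U0)
          = x * P * Q * U2 + (\<gamma> * (P * Q) + \<delta> * (x * Q) + \<epsilon> * (x * P)) * U1 + R * U0"
        if "P \<noteq> 0" "Q \<noteq> 0" for P Q R U0 U1 U2 :: complex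
        using that elim(2) by (simp add: field_simps)
      thus ?thesis
        using elim(3,4) by (simp add: g_def)
    qed
    also have "\<dots> = 0"
      using elim(1) by (simp add: heun_eq_def Let_def \<epsilon>_def)
    finally show ?case .
  qed
  have "isCont g 0"
    using g has_fps_expansion_imp_continuous by blast
  hence "(g \<longlongrightarrow> g 0) (at 0)"
    by (simp add: isCont_def)
  moreover have "(g \<longlongrightarrow> 0) (at 0)"
    using ev by (rule tendsto_eventually)
  ultimately have "g 0 = 0"
    using tendsto_unique trivial_limit_at by blast
  with ev have "\<forall>\<^sub>F x in nhds 0. g x = 0"
    by (simp add: eventually_nhds_conv_at)
  hence "g has_fps_expansion 0"
    by (simp add: has_fps_expansion_0_iff)
  with g show ?thesis
    using fps_expansion_unique_complex by blast
qed

text \<open>The coefficient of \<open>x\<^sup>m\<close> in the equation determines \<open>a * (m + 1) * (\<gamma> + m)\<close> times the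
  coefficient of index \<open>m + 1\<close> through earlier ones.  Applied to the difference of two
  solutions, this kills all coefficients.\<close>

lemma heun_local_solution_unique:
  assumes F: "heun_local_solution a q \<alpha> \<beta> \<gamma> \<delta> u F"
    and G: "heun_local_solution a q \<alpha> \<beta> \<gamma> \<delta> v G"
    and a: "a \<noteq> 0" and \<gamma>: "\<And>m. \<gamma> \<noteq> - of_nat m"
  shows "F = G"
proof -
  define \<epsilon> where "\<epsilon> = \<alpha> + \<beta> + 1 - \<gamma> - \<delta>"
  define D where "D = F - G"
  have "fps_X * (fps_X - 1) * (fps_X - fps_const a) * fps_deriv (fps_deriv D)
         + (fps_const \<gamma> * ((fps_X - 1) * (fps_X - fps_const a))
            + fps_const \<delta> * (fps_X * (fps_X - fps_const a))
            + fps_const \<epsilon> * (fps_X * (fps_X - 1))) * fps_deriv D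
         + (fps_const (\<alpha> * \<beta>) * fps_X - fps_const q) * D = 0" (is "?L = 0")
    using arg_cong2[OF heun_local_solution_fps_eq[OF F a] heun_local_solution_fps_eq[OF G a],
        of "(-)"]
    by (simp only: D_def \<epsilon>_def fps_deriv_sub ring_distribs) (simp add: algebra_simps)
  moreover have "?L =
      fps_X * (fps_X * (fps_X * fps_deriv (fps_deriv D)))
      - fps_X * (fps_X * fps_deriv (fps_deriv D))
      - fps_const a * (fps_X * (fps_X * fps_deriv (fps_deriv D)))
      + fps_const a * (fps_X * fps_deriv (fps_deriv D))
      + fps_const \<gamma> * (fps_X * (fps_X * fps_deriv D))
      - fps_const \<gamma> * (fps_X * fps_deriv D)
      - fps_const \<gamma> * (fps_const a * (fps_X * fps_deriv D))
      + fps_const \<gamma> * (fps_const a * fps_deriv D)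
      + fps_const \<delta> * (fps_X * (fps_X * fps_deriv D))
      - fps_const \<delta> * (fps_const a * (fps_X * fps_deriv D))
      + fps_const \<epsilon> * (fps_X * (fps_X * fps_deriv D))
      - fps_const \<epsilon> * (fps_X * fps_deriv D)
      + fps_const (\<alpha> * \<beta>) * (fps_X * D) - fps_const q * D" (is "_ = ?R")
    by algebra
  ultimately have R: "?R = 0"
    by simp
  have "D $ m = 0" for m
  proof (induction m rule: less_induct)
    case (less m)
    show ?case
    proof (cases m)
      case 0
      have "u 0 = 1" "v 0 = 1" "F $ 0 = u 0" "G $ 0 = v 0"
        using F G by (auto simp: heun_local_solution_def has_fps_expansion_imp_0_eq_fps_nth_0)
      thus ?thesis
        by (simp add: 0 D_def)
    next
      case (Suc l)
      have low: "D $ i = 0" if "i \<le> l" for i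
        using less.IH that Suc by simp
      have X: "(fps_X * H) $ i = (if i = 0 then 0 else H $ (i - 1))" for H :: "complex fps" and i
        by (rule fps_X_mult_nth)
      have "0 = ?R $ l"
        by (simp only: R fps_zero_nth)
      also have "\<dots> = a * (of_nat l * of_nat (Suc l)) * D $ Suc l
                   + \<gamma> * (a * (of_nat (Suc l) * D $ Suc l))"
        by (cases l) (simp_all add: X low)
      also have "\<dots> = a * of_nat (Suc l) * (\<gamma> + of_nat l) * D $ Suc l"
        by (simp add: algebra_simps)
      finally have "a * of_nat (Suc l) * (\<gamma> + of_nat l) * D $ Suc l = 0"
        by simp
      moreover have "\<gamma> + of_nat l \<noteq> 0"
        using \<gamma>[of l] by (simp add: add_eq_0_iff2)
      ultimately show ?thesis
        using a Suc by (simp del: of_nat_Suc)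
    qed
  qed
  thus ?thesis
    by (simp add: D_def fps_eq_iff)
qed

lemma Hl_eqI:
  assumes a: "a \<noteq> 0" and \<gamma>: "\<And>m. \<gamma> \<noteq> - of_nat m"
    and holo: "u holomorphic_on ball 0 r" and u0: "u 0 = 1"
    and ode: "\<And>x. x \<in> ball 0 r \<Longrightarrow> x \<noteq> 0 \<Longrightarrow> heun_eq a q \<alpha> \<beta> \<gamma> \<delta> u x"
    and x: "norm x < r"
  shows "Hl a q \<alpha> \<beta> \<gamma> \<delta> x = u x"
proof -
  have r: "r > 0"
    using x norm_ge_zero[of x] by linarith
  have "\<forall>\<^sub>F x in at 0. x \<in> ball 0 r"
    using r by (intro eventually_at_in_open') auto
  hence "\<forall>\<^sub>F x in at 0. heun_eq a q \<alpha> \<beta> \<gamma> \<delta> u x"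
    using eventually_neq_at_within[of 0 0 UNIV] by eventually_elim (rule ode)
  hence sol: "heun_local_solution a q \<alpha> \<beta> \<gamma> \<delta> u (fps_expansion u 0)"
    using r u0 holo has_fps_expansion_fps_expansion[of "ball 0 r" u]
    by (simp add: heun_local_solution_def)
  have "Hl_fps a q \<alpha> \<beta> \<gamma> \<delta> = fps_expansion u 0"
    unfolding Hl_fps_def using sol heun_local_solution_unique[OF _ sol a \<gamma>] by blast
  moreover have "eval_fps (fps_expansion u 0) x = u (0 + x)"
    by (rule eval_fps_expansion'[of u 0 "ereal r"]) (use holo x in auto)
  ultimately show ?thesis
    by (simp add: Hl_def)
qed

section \<open>Solutions that are finite sums of powers of \<open>1 - 2 * x\<close>\<close>

lemma has_field_derivative_power_sum:
  fixes c :: "nat \<Rightarrow> complex" and r :: "nat \<Rightarrow> int"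
  assumes "1 - 2 * x \<noteq> 0"
  shows "((\<lambda>x. \<Sum>i\<le>N. c i * (1 - 2 * x) powi r i) has_field_derivative
          (\<Sum>i\<le>N. (- 2 * of_int (r i) * c i) * (1 - 2 * x) powi (r i - 1))) (at x)"
  using assms by (auto intro!: derivative_eq_intros sum.cong)

text \<open>The left-hand side of the equation, multiplied by \<open>(s\<^sup>2 - 1) / 4\<close> with \<open>s = 1 - 2 * x\<close>,
  becomes a telescoping sum: the recurrence says that the contribution of one power of \<open>s\<close> to
  the next lower term cancels the contribution of the preceding power.\<close>

lemma heun_eq_half_power_sum:
  fixes k n N :: nat and c :: "nat \<Rightarrow> complex" and x :: complex
  assumes rec: "\<And>i. 2 * (of_nat i + 1) * (2 * of_nat i + 3 - 2 * of_nat n) * c (Suc i)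
                 = (2 * of_nat i + 2 * of_nat k - 2 * of_nat n) * (2 * of_nat i + 2 * of_nat k + 1) * c i"
    and top: "c (Suc N) = 0"
    and x: "x \<noteq> 0" "x \<noteq> 1" "x \<noteq> 1 / 2"
  shows "heun_eq (1 / 2) ((2 * of_nat k - 1) * (of_nat k + of_nat n))
           (2 * (of_nat k + of_nat n)) (2 * of_nat k - 1) (2 * of_nat k) (2 * of_nat k)
           (\<lambda>x. \<Sum>i\<le>N. c i * (1 - 2 * x) powi (1 - 2 * int n + 2 * int i)) x"
proof -
  define r where "r = (\<lambda>i. 1 - 2 * int n + 2 * int i)"
  define u where "u = (\<lambda>x. \<Sum>i\<le>N. c i * (1 - 2 * x) powi r i)"
  define u1 where "u1 = (\<lambda>x. \<Sum>i\<le>N. (- 2 * of_int (r i) * c i) * (1 - 2 * x) powi (r i - 1))"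
  define u2 where "u2 = (\<lambda>x. \<Sum>i\<le>N. (- 2 * of_int (r i - 1) * (- 2 * of_int (r i) * c i))
                                 * (1 - 2 * x) powi (r i - 1 - 1))"
  have nz: "1 - 2 * y \<noteq> 0" if "y \<noteq> 1 / 2" for y :: complex
    using that by (auto simp: field_simps)
  have d1: "deriv u y = u1 y" if "y \<noteq> 1 / 2" for y
    unfolding u_def u1_def
    by (rule DERIV_imp_deriv[OF has_field_derivative_power_sum[OF nz[OF that]]])
  have "\<forall>\<^sub>F y in nhds x. deriv u y = u1 y"
    using t1_space_nhds[OF x(3)] by eventually_elim (rule d1)
  hence "deriv (deriv u) x = deriv u1 x"
    by (rule deriv_cong_ev) simp
  also have "\<dots> = u2 x"
    unfolding u1_def u2_def
    by (rule DERIV_imp_deriv[OF has_field_derivative_power_sum[OF nz[OF x(3)]]])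
  finally have d2: "deriv (deriv u) x = u2 x" .

  define s where "s = 1 - 2 * x"
  have s: "s \<noteq> 0" "s\<^sup>2 - 1 \<noteq> 0" and x_s: "x = (1 - s) / 2"
  proof -
    show "s \<noteq> 0"
      using nz[OF x(3)] by (simp add: s_def)
    have "s\<^sup>2 - 1 = 4 * (x * (x - 1))"
      by (simp add: s_def power2_eq_square algebra_simps)
    thus "s\<^sup>2 - 1 \<noteq> 0"
      using x by simp
  qed (simp add: s_def)
  have den: "x * (x - 1) = (s\<^sup>2 - 1) / 4"
    by (simp add: s_def power2_eq_square algebra_simps)

  define Y where "Y = (\<lambda>i. s powi (r i - 2))"
  have Y0: "s powi (r i) = s\<^sup>2 * Y i" and Y1: "s powi (r i - 1) = s * Y i"
    and Y2: "s powi (r i - 1 - 1) = Y i" and YS: "Y (Suc i) = s\<^sup>2 * Y i" for i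
    using s(1) by (simp_all add: Y_def r_def power_int_diff power_int_add field_simps power2_eq_square)
  define T where "T = (\<lambda>i. (of_int (r i) * (of_int (r i) + 2 * of_nat n - 1)) * c i * Y i)"
  have step: "(of_int (r i) + 2 * of_nat k - 1) * (of_int (r i) + 2 * of_nat k + 2 * of_nat n)
                * c i * (s\<^sup>2 * Y i) = T (Suc i)" for i
    using arg_cong[OF rec[of i], of "\<lambda>z. z * (s\<^sup>2 * Y i)"]
    by (simp add: T_def YS r_def algebra_simps)

  define E where "E = deriv (deriv u) x
     + (2 * of_nat k / x + 2 * of_nat k / (x - 1) + 2 * of_nat n / (x - 1 / 2)) * deriv u x
     + (2 * (of_nat k + of_nat n) * (2 * of_nat k - 1) * x
         - (2 * of_nat k - 1) * (of_nat k + of_nat n)) / (x * (x - 1) * (x - 1 / 2)) * u x"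
  have coeff1: "2 * of_nat k / x + 2 * of_nat k / (x - 1) + 2 * of_nat n / (x - 1 / 2)
      = - 8 * of_nat k * s / (s\<^sup>2 - 1) - 4 * of_nat n / s"
  proof -
    have "2 * of_nat k / x + 2 * of_nat k / (x - 1) = 2 * of_nat k * (2 * x - 1) / (x * (x - 1))"
      using x by (simp add: field_simps)
    also have "\<dots> = - 8 * of_nat k * s / (s\<^sup>2 - 1)"
    proof -
      have "2 * x - 1 = - s"
        by (simp add: s_def)
      thus ?thesis
        unfolding den by simp
    qed
    finally have "2 * of_nat k / x + 2 * of_nat k / (x - 1) = - 8 * of_nat k * s / (s\<^sup>2 - 1)" .
    moreover have "2 * of_nat n / (x - 1 / 2) = - 4 * of_nat n / s"
      using s(1) by (simp add: x_s field_simps)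
    ultimately show ?thesis
      by simp
  qed
  have coeff0: "(2 * (of_nat k + of_nat n) * (2 * of_nat k - 1) * x
         - (2 * of_nat k - 1) * (of_nat k + of_nat n)) / (x * (x - 1) * (x - 1 / 2))
      = 8 * ((2 * of_nat k - 1) * (of_nat k + of_nat n)) / (s\<^sup>2 - 1)"
  proof -
    have "2 * (of_nat k + of_nat n) * (2 * of_nat k - 1) * x
         - (2 * of_nat k - 1) * (of_nat k + of_nat n)
        = 2 * ((2 * of_nat k - 1) * (of_nat k + of_nat n)) * (x - 1 / 2)"
      by (simp add: algebra_simps)
    moreover have "2 * L * d / (M / 4 * d) = 8 * L / M" if "d \<noteq> 0" for L M d :: complex
      using that by simp
    moreover have "x - 1 / 2 \<noteq> 0"
      using x(3) by simp
    ultimately show ?thesis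
      unfolding den by (simp only:)
  qed
  have "(s\<^sup>2 - 1) / 4 * E = (s\<^sup>2 - 1) / 4 * u2 x - (2 * of_nat k * s + of_nat n * (s\<^sup>2 - 1) / s) * u1 x
      + 2 * ((2 * of_nat k - 1) * (of_nat k + of_nat n)) * u x"
  proof -
    have "M / 4 * (v2 + (- 8 * K * s / M - 4 * m / s) * v1 + 8 * L / M * v)
        = M / 4 * v2 - (2 * K * s + m * M / s) * v1 + 2 * L * v"
      if "M \<noteq> 0" for M K L m v v1 v2 :: complex
      using that s(1) by (simp add: field_simps)
    from this[OF s(2)] show ?thesis
      unfolding E_def d2 d1[OF x(3)] coeff1 coeff0 .
  qed
  also have "\<dots> = (\<Sum>i\<le>N. T (Suc i) - T i)"
    unfolding u_def u1_def u2_def s_def[symmetric] Y0 Y1 Y2 step[symmetric] sum_distrib_left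
      sum.distrib[symmetric] sum_subtractf[symmetric]
    by (rule sum.cong) (use s(1) in \<open>simp_all add: T_def field_simps power2_eq_square\<close>)
  also have "\<dots> = T (Suc N) - T 0"
    using sum_lessThan_telescope[of T "Suc N"] by (simp add: lessThan_Suc_atMost)
  also have "\<dots> = 0"
    by (simp add: T_def top r_def)
  finally have "E = 0"
    using s(2) by simp
  thus ?thesis
    by (simp add: heun_eq_def Let_def E_def u_def r_def algebra_simps)
qed

section \<open>Recentring a hypergeometric polynomial\<close>

text \<open>The coefficient of \<open>w ^ i\<close> in the terminating hypergeometric series with parameters
  \<open>- N, a; c\<close> and argument \<open>1 - w\<close>.\<close>

definition recentre_coeff :: "complex \<Rightarrow> complex \<Rightarrow> nat \<Rightarrow> nat \<Rightarrow> complex" where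
  "recentre_coeff a c N i =
     of_nat (N choose i) * pochhammer a i * pochhammer (c - a) (N - i) / pochhammer c N"

lemma Vandermonde_pochhammer_binomial:
  fixes a c :: complex
  assumes c: "\<And>m. c \<noteq> - of_nat m"
  shows "(\<Sum>l\<le>M. of_nat (M choose l) * (- 1) ^ l * (pochhammer a l / pochhammer c l))
         = pochhammer (c - a) M / pochhammer c M"
proof -
  have "of_nat (M choose l) * (- 1) ^ l = pochhammer (- of_nat M) l / (fact l :: complex)" for l
    by (simp add: binomial_gbinomial gbinomial_pochhammer)
  hence "(\<Sum>l\<le>M. of_nat (M choose l) * (- 1) ^ l * (pochhammer a l / pochhammer c l))
      = (\<Sum>l=0..M. (pochhammer a l * pochhammer (- of_nat M) l) / (of_nat (fact l) * pochhammer c l))"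
    unfolding atMost_atLeast0 by (intro sum.cong) simp_all
  thus ?thesis
    using Vandermonde_pochhammer[of M c a] c by simp
qed

text \<open>Expanding \<open>(w - 1) ^ j\<close> and collecting the coefficient of \<open>w ^ i\<close> leaves a
  Chu--Vandermonde sum with both parameters shifted by \<open>i\<close>.\<close>

lemma hypergeometric_recentre:
  fixes a c w :: complex
  assumes c: "\<And>m. c \<noteq> - of_nat m"
  shows "(\<Sum>j\<le>N. of_nat (N choose j) * (pochhammer a j / pochhammer c j) * (w - 1) ^ j)
         = (\<Sum>i\<le>N. recentre_coeff a c N i * w ^ i)"
proof -
  have cS: "c + of_nat i \<noteq> - of_nat m" for i m
    using c[of "i + m"] by (auto simp: algebra_simps eq_neg_iff_add_eq_0)
  define f where "f = (\<lambda>j i. of_nat (N choose j) * (pochhammer a j / pochhammer c j)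
                      * (of_nat (j choose i) * w ^ i * (- 1) ^ (j - i)))"
  have "(\<Sum>j\<le>N. of_nat (N choose j) * (pochhammer a j / pochhammer c j) * (w - 1) ^ j)
      = (\<Sum>j\<le>N. \<Sum>i\<le>j. f j i)"
    unfolding f_def sum_distrib_left[symmetric] binomial_ring[of w "- 1", symmetric] by simp
  also have "\<dots> = (\<Sum>i\<le>N. \<Sum>j=i..N. f j i)"
    by (subst (1 2) sum.Sigma, simp, simp, simp, simp)
      (rule sum.reindex_bij_witness[of _ "\<lambda>(i, j). (j, i)" "\<lambda>(j, i). (i, j)"], auto)
  also have "\<dots> = (\<Sum>i\<le>N. recentre_coeff a c N i * w ^ i)"
  proof (rule sum.cong)
    fix i assume "i \<in> {..N}"
    hence i: "i \<le> N" by simp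
    have "(\<Sum>j=i..N. f j i) = (\<Sum>l\<le>N - i. f (i + l) i)"
      using i by (intro sum.reindex_bij_witness[of _ "\<lambda>l. i + l" "\<lambda>j. j - i"]) auto
    also have "\<dots> = (\<Sum>l\<le>N - i. (of_nat (N choose i) * pochhammer a i / pochhammer c i * w ^ i) *
        (of_nat (N - i choose l) * (- 1) ^ l
          * (pochhammer (a + of_nat i) l / pochhammer (c + of_nat i) l)))"
    proof (rule sum.cong)
      fix l assume "l \<in> {..N - i}"
      hence "(N choose (i + l)) * ((i + l) choose i) = (N choose i) * (N - i choose l)"
        using choose_mult[of i "i + l" N] i by simp
      from arg_cong[OF this, of "of_nat :: nat \<Rightarrow> complex"]
      have ch: "of_nat (N choose (i + l)) * of_nat ((i + l) choose i)
          = (of_nat (N choose i) * of_nat (N - i choose l) :: complex)"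
        by (simp only: of_nat_mult)
      have "f (i + l) i = (of_nat (N choose (i + l)) * of_nat ((i + l) choose i))
          * (pochhammer a (i + l) / pochhammer c (i + l)) * w ^ i * (- 1) ^ l"
        by (simp add: f_def)
      thus "f (i + l) i = (of_nat (N choose i) * pochhammer a i / pochhammer c i * w ^ i) *
        (of_nat (N - i choose l) * (- 1) ^ l
          * (pochhammer (a + of_nat i) l / pochhammer (c + of_nat i) l))"
        unfolding ch pochhammer_product' by simp
    qed simp
    also have "\<dots> = of_nat (N choose i) * pochhammer a i / pochhammer c i * w ^ i *
        (pochhammer (c - a) (N - i) / pochhammer (c + of_nat i) (N - i))"
      unfolding sum_distrib_left[symmetric] using Vandermonde_pochhammer_binomial[OF cS]
      by simp
    also have "\<dots> = recentre_coeff a c N i * w ^ i"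
      using pochhammer_product[OF i, of c] by (simp add: recentre_coeff_def)
    finally show "(\<Sum>j=i..N. f j i) = recentre_coeff a c N i * w ^ i" .
  qed simp
  finally show ?thesis .
qed

text \<open>The ratio of consecutive coefficients; the vanishing of \<open>N choose i\<close> for \<open>i > N\<close> makes it
  hold for all \<open>i\<close>, including the place where the sum breaks off.\<close>

lemma recentre_coeff_Suc:
  "(of_nat i + 1) * (c - a + of_nat N - of_nat i - 1) * recentre_coeff a c N (Suc i)
   = (of_nat N - of_nat i) * (a + of_nat i) * recentre_coeff a c N i"
proof (cases "i < N")
  case True
  then obtain m where N: "N = Suc (i + m)"
    using less_iff_Suc_add by blast
  have "Suc i * (N choose Suc i) = (N - i) * (N choose i)"
    using binomial_absorb_comp[of N i] binomial_absorption[of i N] by simp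
  from arg_cong[OF this, of "of_nat :: nat \<Rightarrow> complex"]
  have ch: "(of_nat i + 1) * of_nat (N choose Suc i) = ((of_nat N - of_nat i) * of_nat (N choose i) :: complex)"
    using of_nat_diff[OF less_imp_le[OF True], where ?'a = complex]
    by (simp only: of_nat_mult of_nat_Suc add.commute)
  have "(of_nat i + 1) * (c - a + of_nat N - of_nat i - 1) * recentre_coeff a c N (Suc i)
     = ((of_nat i + 1) * of_nat (N choose Suc i)) * (a + of_nat i) * pochhammer a i
         * (pochhammer (c - a) m * (c - a + of_nat m)) / pochhammer c N"
    by (simp add: recentre_coeff_def N pochhammer_Suc algebra_simps)
  also have "\<dots> = (of_nat N - of_nat i) * (a + of_nat i) * recentre_coeff a c N i"
    unfolding ch by (simp add: recentre_coeff_def N pochhammer_Suc)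
  finally show ?thesis .
qed (auto simp: recentre_coeff_def not_less le_less binomial_eq_0)

section \<open>The coefficients in terms of binomials\<close>

lemma pochhammer_half_shift:
  "pochhammer (of_nat m + 1 / 2 :: complex) i = pochhammer (1 / 2) (m + i) / pochhammer (1 / 2) m"
proof -
  have "pochhammer (1 / 2 :: complex) m \<noteq> 0"
    using fact_double[of m, where ?'a = complex] by (metis fact_nonzero mult_zero_left mult_zero_right)
  thus ?thesis
    using pochhammer_product'[of "1 / 2 :: complex" m i] by (simp add: add.commute)
qed

text \<open>Both sides become products of factorials, powers of two and values \<open>pochhammer (1/2) m\<close>
  once every factorial of an even number is split by the duplication formula.\<close>

lemma recentre_coeff_binomial:
  assumes k: "1 \<le> k" and i: "i + k \<le> n"
  shows "2 ^ (2 * k - 1) / (of_nat ((n + k - 1) choose (k - 1)) * of_nat ((n - 1) choose (k - 1)))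
         * (of_nat ((2 * n - 2 * i - 2) choose (2 * k - 2)) * of_nat ((n - 1) choose i)
             * r_coeff n (k + i))
         = recentre_coeff (of_nat k + 1 / 2) (2 * of_nat k) (n - k) i"
proof -
  obtain p where p: "k = Suc p"
    using k by (cases k) auto
  obtain m where n: "n = Suc (p + i + m)"
    using i p by (metis add.commute add.left_commute add_Suc le_Suc_ex)
  define H where "H = (pochhammer (1 / 2) :: nat \<Rightarrow> complex)"
  have H: "H j \<noteq> 0" for j
    using fact_double[of j, where ?'a = complex] unfolding H_def
    by (metis fact_nonzero mult_zero_left mult_zero_right)
  have dbl: "fact (2 * j) = 4 ^ j * H j * (fact j :: complex)" for j
    by (simp add: fact_double H_def power_mult)
  have HS: "H (Suc j) = H j * (of_nat j + 1 / 2)" for j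
    by (simp add: H_def pochhammer_Suc add.commute)
  have binom: "of_nat (a choose b) = (fact a / (fact b * fact d) :: complex)" if "a = b + d" for a b d
    using binomial_fact[of b a, where ?'a = complex] that by simp
  have b1: "of_nat ((n + k - 1) choose (k - 1)) = (fact (p + n) / (fact p * fact n) :: complex)"
    and b2: "of_nat ((n - 1) choose (k - 1)) = (fact (p + i + m) / (fact p * fact (i + m)) :: complex)"
    and b3: "of_nat ((2 * n - 2 * i - 2) choose (2 * k - 2))
      = (fact (2 * (p + m)) / (fact (2 * p) * fact (2 * m)) :: complex)"
    and b4: "of_nat ((n - 1) choose i) = (fact (p + i + m) / (fact i * fact (p + m)) :: complex)"
    and b5: "of_nat (n choose (k + i)) = (fact n / (fact (k + i) * fact m) :: complex)"
    and b6: "of_nat ((2 * (k + i)) choose (k + i))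
      = (fact (2 * (k + i)) / (fact (k + i) * fact (k + i)) :: complex)"
    and b7: "of_nat ((2 * n - 2 * (k + i)) choose (n - (k + i)))
      = (fact (2 * m) / (fact m * fact m) :: complex)"
    and b8: "of_nat ((n - k) choose i) = (fact (i + m) / (fact i * fact m) :: complex)"
    using binom[of "n + k - 1" "k - 1" n] binom[of "n - 1" "k - 1" "i + m"]
      binom[of "2 * n - 2 * i - 2" "2 * k - 2" "2 * m"] binom[of "n - 1" i "p + m"]
      binom[of n "k + i" m] binom[of "2 * (k + i)" "k + i" "k + i"]
      binom[of "2 * n - 2 * (k + i)" "n - (k + i)" m] binom[of "n - k" i m]
    by (simp_all add: n p add_ac del: fact_Suc)
  have q1: "pochhammer (of_nat k + 1 / 2) i = H (k + i) / H k"
    unfolding H_def by (rule pochhammer_half_shift)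
  have q2: "pochhammer (2 * of_nat k - (of_nat k + 1 / 2)) (n - k - i) = H (p + m) / H p"
    using pochhammer_half_shift[of p m] by (simp add: H_def n p algebra_simps)
  have q3: "pochhammer (2 * of_nat k) (n - k) = (fact (p + n) / fact (2 * p + 1) :: complex)"
  proof -
    have "p + n = 2 * p + 1 + (n - k)" "2 * of_nat k = (1 + of_nat (2 * p + 1) :: complex)"
      by (simp_all add: n p)
    hence "fact (p + n) = fact (2 * p + 1) * (pochhammer (2 * of_nat k) (n - k) :: complex)"
      using pochhammer_product'[of "1 :: complex" "2 * p + 1" "n - k"]
      by (simp only: pochhammer_fact)
    thus ?thesis
      by (simp del: fact_Suc)
  qed
  have fo: "fact (2 * p + 1) = (of_nat (2 * p + 1) * (4 ^ p * H p * fact p) :: complex)"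
    by (simp add: dbl[symmetric])
  have odd: "of_nat (2 * p + 1) = (2 * (of_nat p + 1 / 2) :: complex)" "of_nat p + 1 / 2 \<noteq> (0 :: complex)"
    using of_nat_neq_0[of "2 * p", where ?'a = complex] by (simp_all add: field_simps)
  have pow: "2 ^ (2 * k - 1) = (2 * 4 ^ p :: complex)" "(4::complex) ^ n = 4 * (4 ^ p * 4 ^ i * 4 ^ m)"
    by (simp_all add: p n power_add power_mult)
  have Hk: "H k = H p * (of_nat p + 1 / 2)"
    using HS p by simp
  have p4: "(4::complex) ^ (k + i) = 4 * 4 ^ p * 4 ^ i" "(4::complex) ^ (p + m) = 4 ^ p * 4 ^ m"
    by (simp_all add: p power_add)
  have r: "r_coeff n (k + i)
      = 4 ^ (k + i) * H (k + i) * fact (k + i) * fact m * fact (2 * m)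
        / (fact (k + i) * fact m * fact m * fact n * 4 ^ n)"
    unfolding r_coeff_def b5 b6 b7 dbl[of "k + i"] by (simp add: field_simps)
  show ?thesis
    unfolding recentre_coeff_def b1 b2 b3 b4 b8 q1 q2 q3 r dbl fo odd(1) pow Hk p4
    using H odd(2) by (simp add: divide_simps)
qed

section \<open>The closed forms\<close>

theorem mainTheorem10:
  fixes k n :: nat and x :: complex
  assumes "1 \<le> k" and "k \<le> n" and "norm x < 1 / 2"
  shows "Hl (1 / 2) ((2 * of_nat k - 1) * (of_nat k + of_nat n))
             (2 * (of_nat k + of_nat n)) (2 * of_nat k - 1) (2 * of_nat k) (2 * of_nat k) x
         = 2 ^ (2 * k - 1)
             / (of_nat ((n + k - 1) choose (k - 1)) * of_nat ((n - 1) choose (k - 1)))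
             * (\<Sum>i = 0..n - k.
                  of_nat ((2 * n - 2 * i - 2) choose (2 * k - 2)) * of_nat ((n - 1) choose i)
                  * r_coeff n (k + i) * (1 - 2 * x) powi (1 - 2 * int n + 2 * int i))
         \<and> Hl (1 / 2) ((2 * of_nat k - 1) * (of_nat k + of_nat n))
             (2 * (of_nat k + of_nat n)) (2 * of_nat k - 1) (2 * of_nat k) (2 * of_nat k) x
         = (1 - 2 * x) powi (1 - 2 * int n)
             * (\<Sum>j = 0..n - k.
                  4 ^ j * of_nat ((n - k) choose j)
                  * (pochhammer (of_nat k + 1 / 2) j / pochhammer (2 * of_nat k) j)
                  * (x ^ 2 - x) ^ j)"
proof -
  define N where "N = n - k"
  define c where "c = recentre_coeff (of_nat k + 1 / 2) (2 * of_nat k) N"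
  define u where "u = (\<lambda>x. \<Sum>i\<le>N. c i * (1 - 2 * x) powi (1 - 2 * int n + 2 * int i))"
  have n: "of_nat n = (of_nat N + of_nat k :: complex)"
    using assms(2) by (simp add: N_def of_nat_diff)
  have \<gamma>: "2 * of_nat k \<noteq> (- of_nat m :: complex)" for m
  proof -
    have "of_nat (2 * k + m) \<noteq> (0 :: complex)"
      using assms(1) by (subst of_nat_eq_0_iff) simp
    thus ?thesis
      by (simp add: eq_neg_iff_add_eq_0)
  qed
  have half: "y \<noteq> 1 / 2" if "norm y < 1 / 2" for y :: complex
  proof
    assume "y = 1 / 2"
    with that show False
      by (simp add: norm_divide)
  qed
  have nz: "1 - 2 * y \<noteq> 0" if "norm y < 1 / 2" for y :: complex
    using half[OF that] by (simp add: field_simps)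

  have second: "u y = (1 - 2 * y) powi (1 - 2 * int n) * (\<Sum>j = 0..n - k.
                  4 ^ j * of_nat ((n - k) choose j)
                  * (pochhammer (of_nat k + 1 / 2) j / pochhammer (2 * of_nat k) j)
                  * (y ^ 2 - y) ^ j)" if y: "norm y < 1 / 2" for y
  proof -
    have w: "(1 - 2 * y)\<^sup>2 - 1 = 4 * (y ^ 2 - y)"
      by (simp add: power2_eq_square algebra_simps)
    have "u y = (1 - 2 * y) powi (1 - 2 * int n) * (\<Sum>i\<le>N. c i * ((1 - 2 * y)\<^sup>2) ^ i)"
      unfolding u_def sum_distrib_left
    proof (rule sum.cong)
      fix i
      have "(1 - 2 * y) powi (2 * int i) = ((1 - 2 * y)\<^sup>2) ^ i"
        by (simp add: power_int_mult)
      thus "c i * (1 - 2 * y) powi (1 - 2 * int n + 2 * int i)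
          = (1 - 2 * y) powi (1 - 2 * int n) * (c i * ((1 - 2 * y)\<^sup>2) ^ i)"
        using nz[OF y] by (simp add: power_int_add)
    qed simp
    also have "(\<Sum>i\<le>N. c i * ((1 - 2 * y)\<^sup>2) ^ i) = (\<Sum>j\<le>N. of_nat (N choose j)
        * (pochhammer (of_nat k + 1 / 2) j / pochhammer (2 * of_nat k) j) * (4 * (y ^ 2 - y)) ^ j)"
      unfolding c_def hypergeometric_recentre[OF \<gamma>, symmetric] w ..
    also have "\<dots> = (\<Sum>j\<le>N. 4 ^ j * of_nat (N choose j)
        * (pochhammer (of_nat k + 1 / 2) j / pochhammer (2 * of_nat k) j) * (y ^ 2 - y) ^ j)"
      by (intro sum.cong) (simp_all only: power_mult_distrib mult_ac)
    finally show ?thesis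
      by (simp only: N_def atMost_atLeast0)
  qed

  have u0: "u 0 = 1"
    using second[of 0] by (simp add: power_0_left if_distrib sum.atLeast_Suc_atMost)
  have holo: "u holomorphic_on ball 0 (1 / 2)"
    unfolding u_def using nz by (intro holomorphic_intros) auto
  have ode: "heun_eq (1 / 2) ((2 * of_nat k - 1) * (of_nat k + of_nat n))
             (2 * (of_nat k + of_nat n)) (2 * of_nat k - 1) (2 * of_nat k) (2 * of_nat k) u y"
    if "y \<in> ball 0 (1 / 2)" "y \<noteq> 0" for y
    unfolding u_def
  proof (rule heun_eq_half_power_sum)
    fix i
    show "2 * (of_nat i + 1) * (2 * of_nat i + 3 - 2 * of_nat n) * c (Suc i)
        = (2 * of_nat i + 2 * of_nat k - 2 * of_nat n) * (2 * of_nat i + 2 * of_nat k + 1) * c i"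
    proof -
      have "2 * (of_nat i + 1) * (2 * of_nat i + 3 - 2 * of_nat n) * c (Suc i)
          = - 4 * ((of_nat i + 1) * (2 * of_nat k - (of_nat k + 1 / 2) + of_nat N - of_nat i - 1) * c (Suc i))"
        by (simp add: n field_simps)
      also have "\<dots> = - 4 * ((of_nat N - of_nat i) * (of_nat k + 1 / 2 + of_nat i) * c i)"
        unfolding c_def recentre_coeff_Suc ..
      also have "\<dots> = (2 * of_nat i + 2 * of_nat k - 2 * of_nat n) * (2 * of_nat i + 2 * of_nat k + 1) * c i"
        by (simp add: n field_simps)
      finally show ?thesis .
    qed
    show "y \<noteq> 1 / 2"
      using that by (intro half) simp
  qed (use that in \<open>auto simp: c_def recentre_coeff_def\<close>)
  have Hl_u: "Hl (1 / 2) ((2 * of_nat k - 1) * (of_nat k + of_nat n))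
             (2 * (of_nat k + of_nat n)) (2 * of_nat k - 1) (2 * of_nat k) (2 * of_nat k) x = u x"
    by (rule Hl_eqI[OF _ \<gamma> holo u0 ode assms(3)]) auto
  have first: "u x = 2 ^ (2 * k - 1)
             / (of_nat ((n + k - 1) choose (k - 1)) * of_nat ((n - 1) choose (k - 1)))
             * (\<Sum>i = 0..n - k.
                  of_nat ((2 * n - 2 * i - 2) choose (2 * k - 2)) * of_nat ((n - 1) choose i)
                  * r_coeff n (k + i) * (1 - 2 * x) powi (1 - 2 * int n + 2 * int i))"
    unfolding u_def sum_distrib_left atMost_atLeast0 N_def
  proof (rule sum.cong)
    fix i assume "i \<in> {0..n - k}"
    hence "i + k \<le> n"
      using assms(2) by simp
    from recentre_coeff_binomial[OF assms(1) this, symmetric]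
    show "c i * (1 - 2 * x) powi (1 - 2 * int n + 2 * int i)
        = 2 ^ (2 * k - 1)
          / (of_nat ((n + k - 1) choose (k - 1)) * of_nat ((n - 1) choose (k - 1)))
          * (of_nat ((2 * n - 2 * i - 2) choose (2 * k - 2)) * of_nat ((n - 1) choose i)
              * r_coeff n (k + i) * (1 - 2 * x) powi (1 - 2 * int n + 2 * int i))"
      unfolding c_def N_def by (simp add: mult.assoc)
  qed simp
  show ?thesis
    using Hl_u first second[OF assms(3)] by simp
qed

end
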